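(* Let $(I,\boldsymbol{p})$ be an implementable pair where $I=\{B_1,\ldots,B_n\}$ is labeled so that $\mathbb{E}_{\lambda_{B_1}}(X)<\cdots<\mathbb{E}_{\lambda_{B_n}}(X)$. Suppose that $m(1-F(m))$ is strictly quasi-concave on $[a,b]$. Let $$J=\left[\frac{p(B_1)}{\mathbb{E}_{\lambda_{B_1}}(X)},\ \frac{p(B_n)-p(B_{n-1})}{\mathbb{E}_{\lambda_{B_n}}(X)-\mathbb{E}_{\lambda_{B_{n-1}}}(X)}\right],$$ with the convention $p(B_0)=\mathbb{E}_{\lambda_{B_0}}(X)=0$. (i) If $F(m)m$ is convex on $J$ and $S_{\{B_n\}}(B_n,p^M(B_n))\ge D_{\{B_n\}}(B_n,p^M(B_n))$, then $\pi^Q(I)\le\pi^Q(\{B_n\})$. (ii) If $F(m)m$ is concave on $J$ and $p(B_n)\ge p^M(B_n)$, then $\pi^Q(I)\ge\pi^Q(\{B_n\})$.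
   Context: Sellers and information. Sellers' quality levels lie in $X=[0,\overline{x}]$, $\overline{x}>0$, distributed according to a Borel probability measure $\phi$ on $X$. The platform's information is a finite measurable partition $I_o=\{A_1,\ldots,A_l\}$ of $X$ with $\phi(A_i)>0$. An information structure is a nonempty family $I=\{B_1,\ldots,B_n\}$ of pairwise disjoint nonempty sets, each a union of elements of $I_o$. A pricing function for $I$ is a vector $\boldsymbol{p}=(p(B_1),\ldots,p(B_n))$ of nonnegative prices; it is positive if all $p(B_i)>0$. Supply. Fix $\alpha>0$ and a measurable $k:X\to(0,\infty)$ bounded below by a positive number. A type $x\in B_i$ seller chooses $g(x,p(B_i))=\operatorname{argmax}_{h\ge0}\left[h\,p(B_i)-k(x)h^{\alpha+1}/(\alpha+1)\right]$. The supply is $S_I(B_i,p(B_i))=\int_{B_i}g(x,p(B_i))\,\phi(dx)$. Buyers. Types $m$ are distributed according to a cumulative distribution function $F$ (on $\mathbb{R}$) with continuous density, supported on $[a,b]\subseteq[0,\infty)$, $a<b$ ($F$ strictly increasing on $[a,b]$). Given beliefs $\lambda_{B_i}$ (probability measures on $B_i$), with mean quality $\mathbb{E}_{\lambda_{B_i}}(X)$, a type $m$ buyer's utility from buying in $B_i$ is $Z(m,B_i,p(B_i))=m\,\mathbb{E}_{\lambda_{B_i}}(X)-p(B_i)$, and not buying gives $0$. Demand is $D_I(B_i,\boldsymbol{p})=\int_a^b1\{Z(m,B_i,p(B_i))\ge0\}1\{Z(m,B_i,p(B_i))=\max_{B\in I}Z(m,B,p(B))\}F(dm)$, ties being broken in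 favor of the set with the highest index. Beliefs are consistent: $\lambda_{B_i}(A)=\int_A g(x,p(B_i))\phi(dx)\big/\int_{B_i}g(x,p(B_i))\phi(dx)$ for measurable $A\subseteq B_i$. For positive prices the mean does not depend on the prices: $\mathbb{E}_{\lambda_B}(X)=\int_Bxk(x)^{-1/\alpha}\phi(dx)/\int_Bk(x)^{-1/\alpha}\phi(dx)$. Equilibrium. For $I$ and a positive pricing function $\boldsymbol{p}$, an equilibrium consists of the demands $\{D_I(B_i,\boldsymbol{p})\}_{i=1}^n$, the supplies $\{S_I(B_i,p(B_i))\}_{i=1}^n$ and consistent beliefs $\{\lambda_{B_i}\}_{i=1}^n$ such that $S_I(B_i,p(B_i))=D_I(B_i,\boldsymbol{p})$ for all $B_i\in I$. $(I,\boldsymbol{p})$ is implementable if $\boldsymbol{p}$ is positive and an equilibrium exists; for each $I$ there is at most one such $\boldsymbol{p}$. $\pi^Q(I)$ denotes the revenue $\sum_{B_i\in I}p(B_i)\min\{D_I(B_i,\boldsymbol{p}),S_I(B_i,p(B_i))\}$ at the unique pricing function $\boldsymbol{p}$ for which $(I,\boldsymbol{p})$ is implementable (for $I$ implementable, $\{B_n\}$ also has such a price). For $\mathbb{E}_{\lambda_B}(X)>0$, $p^M(B)=\operatorname{argmax}_{p\ge0}p\,(1-F(p/\mathbb{E}_{\lambda_B}(X)))$, which is unique under the strict quasi-concavity assumption. *)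

theory Defs
  imports "HOL-Probability.Probability"
begin

text \<open>
  Sellers: \<open>\<phi>\<close> is a Borel probability measure on the interval of quality levels. Buyers: \<open>\<mu>\<close> is the
  law of the types, and its cumulative distribution function is \<open>cdf \<mu>\<close>.
  An information structure is a list \<open>Bs\<close> of sets and a pricing function for it is a list of the
  same length. Positions matter because ties between sets are broken by the index.
\<close>

definition buyer_distribution :: "real \<Rightarrow> real \<Rightarrow> real measure \<Rightarrow> bool" where
  "buyer_distribution a b \<mu> \<longleftrightarrow>
     real_distribution \<mu> \<and> 0 \<le> a \<and> a < b \<and>
     (\<exists>f. continuous_on {a..b} f \<and> (\<forall>m\<in>{a..b}. 0 \<le> f m) \<and>
          \<mu> = density lborel (\<lambda>m. ennreal (f m) * indicator {a..b} m)) \<and>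
     strict_mono_on {a..b} (cdf \<mu>)"

definition info_structure :: "real set set \<Rightarrow> real set list \<Rightarrow> bool" where
  "info_structure Io Bs \<longleftrightarrow>
     Bs \<noteq> [] \<and> disjoint_family_on (\<lambda>i. Bs ! i) {..<length Bs} \<and>
     (\<forall>B\<in>set Bs. B \<noteq> {} \<and> (\<exists>C\<subseteq>Io. B = \<Union>C))"

definition seller_quantity :: "real \<Rightarrow> (real \<Rightarrow> real) \<Rightarrow> real \<Rightarrow> real \<Rightarrow> real" where
  "seller_quantity \<alpha> k x q =
     arg_max (\<lambda>h. h * q - k x * h powr (\<alpha> + 1) / (\<alpha> + 1)) (\<lambda>h. 0 \<le> h)"

definition aggregate_supply :: "real measure \<Rightarrow> real \<Rightarrow> (real \<Rightarrow> real) \<Rightarrow> real set \<Rightarrow> real \<Rightarrow> real" where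
  "aggregate_supply \<phi> \<alpha> k B q = (LINT x:B|\<phi>. seller_quantity \<alpha> k x q)"

definition consistent_belief ::
  "real measure \<Rightarrow> real \<Rightarrow> (real \<Rightarrow> real) \<Rightarrow> real set \<Rightarrow> real \<Rightarrow> real measure \<Rightarrow> bool" where
  "consistent_belief \<phi> \<alpha> k B q l \<longleftrightarrow>
     prob_space l \<and> sets l = sets (restrict_space \<phi> B) \<and>
     (\<forall>A\<in>sets l. measure l A = aggregate_supply \<phi> \<alpha> k A q / aggregate_supply \<phi> \<alpha> k B q)"

text \<open>For a positive price and a set of positive mass the consistent belief is unique.\<close>

definition belief ::
  "real measure \<Rightarrow> real \<Rightarrow> (real \<Rightarrow> real) \<Rightarrow> real set \<Rightarrow> real \<Rightarrow> real measure" where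
  "belief \<phi> \<alpha> k B q = (THE l. consistent_belief \<phi> \<alpha> k B q l)"

definition beliefs ::
  "real measure \<Rightarrow> real \<Rightarrow> (real \<Rightarrow> real) \<Rightarrow> real set list \<Rightarrow> real list \<Rightarrow> real measure list" where
  "beliefs \<phi> \<alpha> k Bs ps = map2 (belief \<phi> \<alpha> k) Bs ps"

definition mean_quality :: "real measure \<Rightarrow> real" where
  "mean_quality l = (LINT x|l. x)"

definition utility :: "real \<Rightarrow> real measure \<Rightarrow> real \<Rightarrow> real" where
  "utility m l q = m * mean_quality l - q"

text \<open>
  Demand for the set at position \<open>i\<close> (counted from 0), given the list \<open>ls\<close> of beliefs, one for
  each set, and the price list \<open>ps\<close>.
\<close>

definition demand ::
  "real \<Rightarrow> real \<Rightarrow> real measure \<Rightarrow> real measure list \<Rightarrow> real list \<Rightarrow> nat \<Rightarrow> real" where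
  "demand a b \<mu> ls ps i =
     (LINT m:{a..b}|\<mu>.
        of_bool (0 \<le> utility m (ls ! i) (ps ! i)) *
        of_bool ((\<forall>j<length ls. utility m (ls ! j) (ps ! j) \<le> utility m (ls ! i) (ps ! i)) \<and>
                 (\<forall>j<length ls. i < j \<longrightarrow>
                    utility m (ls ! j) (ps ! j) \<noteq> utility m (ls ! i) (ps ! i))))"

definition equilibrium ::
  "real measure \<Rightarrow> real \<Rightarrow> (real \<Rightarrow> real) \<Rightarrow> real \<Rightarrow> real \<Rightarrow> real measure \<Rightarrow>
   real set list \<Rightarrow> real list \<Rightarrow> real measure list \<Rightarrow> bool" where
  "equilibrium \<phi> \<alpha> k a b \<mu> Bs ps ls \<longleftrightarrow>
     length ps = length Bs \<and> length ls = length Bs \<and>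
     (\<forall>i<length Bs.
        0 < ps ! i \<and>
        consistent_belief \<phi> \<alpha> k (Bs ! i) (ps ! i) (ls ! i) \<and>
        aggregate_supply \<phi> \<alpha> k (Bs ! i) (ps ! i) = demand a b \<mu> ls ps i)"

definition implementable ::
  "real measure \<Rightarrow> real \<Rightarrow> (real \<Rightarrow> real) \<Rightarrow> real \<Rightarrow> real \<Rightarrow> real measure \<Rightarrow>
   real set list \<Rightarrow> real list \<Rightarrow> bool" where
  "implementable \<phi> \<alpha> k a b \<mu> Bs ps \<longleftrightarrow> (\<exists>ls. equilibrium \<phi> \<alpha> k a b \<mu> Bs ps ls)"

definition revenue ::
  "real measure \<Rightarrow> real \<Rightarrow> (real \<Rightarrow> real) \<Rightarrow> real \<Rightarrow> real \<Rightarrow> real measure \<Rightarrow>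
   real set list \<Rightarrow> real list \<Rightarrow> real" where
  "revenue \<phi> \<alpha> k a b \<mu> Bs ps =
     (\<Sum>i<length Bs. ps ! i *
        min (demand a b \<mu> (beliefs \<phi> \<alpha> k Bs ps) ps i) (aggregate_supply \<phi> \<alpha> k (Bs ! i) (ps ! i)))"

definition equilibrium_revenue ::
  "real measure \<Rightarrow> real \<Rightarrow> (real \<Rightarrow> real) \<Rightarrow> real \<Rightarrow> real \<Rightarrow> real measure \<Rightarrow>
   real set list \<Rightarrow> real" where
  "equilibrium_revenue \<phi> \<alpha> k a b \<mu> Bs =
     revenue \<phi> \<alpha> k a b \<mu> Bs (THE ps. implementable \<phi> \<alpha> k a b \<mu> Bs ps)"

text \<open>
  The monopoly price of a set depends on it only through the mean quality \<open>e\<close>, which is the same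
  for all positive prices.
\<close>

definition monopoly_price :: "real measure \<Rightarrow> real \<Rightarrow> real" where
  "monopoly_price \<mu> e = arg_max (\<lambda>q. q * (1 - cdf \<mu> (q / e))) (\<lambda>q. 0 \<le> q)"

definition strictly_quasi_concave_on :: "real set \<Rightarrow> (real \<Rightarrow> real) \<Rightarrow> bool" where
  "strictly_quasi_concave_on S f \<longleftrightarrow>
     convex S \<and>
     (\<forall>x\<in>S. \<forall>y\<in>S. \<forall>t\<in>{0<..<1}. x \<noteq> y \<longrightarrow> min (f x) (f y) < f ((1 - t) * x + t * y))"

text \<open>
  Interval between the lowest and the highest threshold type for a nonempty list \<open>ps\<close> of prices and
  a list \<open>es\<close> of mean qualities. Prefixing 0 implements the convention that price and mean quality
  at index 0 vanish, so that \<open>(0 # ps) ! i\<close> is the \<open>i\<close>-th price counted from 1.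
\<close>

definition threshold_interval :: "real list \<Rightarrow> real list \<Rightarrow> real set" where
  "threshold_interval ps es =
     (let P = (\<lambda>i. (0 # ps) ! i); E = (\<lambda>i. (0 # es) ! i); n = length ps
      in {P 1 / E 1 .. (P n - P (n - 1)) / (E n - E (n - 1))})"

end

theory Submission
  imports Defs
begin

text \<open>
  Write \<open>e\<^sub>i\<close> for the mean qualities, \<open>T\<^sub>i = (p\<^sub>i - p\<^sub>i\<^sub>-\<^sub>1) / (e\<^sub>i - e\<^sub>i\<^sub>-\<^sub>1)\<close> for the threshold types
  and \<open>G m = F m * m\<close>. Supply is positive, so in equilibrium every set is chosen by some type. This
  forces the thresholds to increase, and the set with index \<open>i\<close> is chosen exactly by the types
  between \<open>T\<^sub>i\<close> and \<open>T\<^sub>i\<^sub>+\<^sub>1\<close>. Summation by parts turns the revenue into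
  \<open>p\<^sub>n - (\<Sum>i. (e\<^sub>i - e\<^sub>i\<^sub>-\<^sub>1) * G T\<^sub>i)\<close>. The weights \<open>(e\<^sub>i - e\<^sub>i\<^sub>-\<^sub>1) / e\<^sub>n\<close> average the thresholds
  to \<open>p\<^sub>n / e\<^sub>n\<close>, so by Jensen's inequality the convexity (concavity) of \<open>G\<close> bounds the revenue
  from above (below) by the revenue \<open>R p\<^sub>n\<close> with \<open>R q = q * (1 - F (q / e\<^sub>n))\<close> of the last set sold
  alone. As \<open>T\<^sub>n\<close> is at least that average, the last set alone is in excess demand at
  \<open>p\<^sub>n\<close>, so its own equilibrium price \<open>q\<close> satisfies \<open>p\<^sub>n \<le> q\<close>. Finally \<open>R\<close> increases up to the
  monopoly price and decreases afterwards; the hypotheses put \<open>p\<^sub>n\<close> and \<open>q\<close> on the left of the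
  monopoly price in (i) and on the right in (ii).
\<close>

section \<open>Optimal quantities of the sellers\<close>

text \<open>The strict bound \<open>ln u < u - 1\<close> at \<open>u = 1 / t\<close> bounds
  \<open>ln t\<close> from below; exponentiating \<open>(s - 1) * ln t\<close> and multiplying by
  \<open>t\<close> gives the claim. Strictness is what makes a seller's optimum unique.\<close>

lemma Bernoulli_powr_strict:
  fixes t s :: real
  assumes "0 \<le> t" "t \<noteq> 1" "1 < s"
  shows "1 + s * (t - 1) < t powr s"
proof (cases "t = 0")
  case True
  then show ?thesis using assms by simp
next
  case False
  with assms have t: "0 < t" by simp
  have "ln (1 / t) \<noteq> 1 / t - 1"
    using ln_eq_minus_one[of "1 / t"] t assms by auto
  moreover have "ln (1 / t) \<le> 1 / t - 1"
    using ln_le_minus_one[of "1 / t"] t by simp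
  ultimately have "1 - 1 / t < ln t"
    using t by (simp add: ln_div)
  then have "1 + (s - 1) * (1 - 1 / t) < 1 + (s - 1) * ln t"
    using assms by simp
  also have "\<dots> \<le> t powr (s - 1)"
    using exp_ge_add_one_self[of "(s - 1) * ln t"] t by (simp add: powr_def)
  finally have "t * (1 + (s - 1) * (1 - 1 / t)) < t * t powr (s - 1)"
    using t by simp
  also have "t * t powr (s - 1) = t powr s"
    using t by (simp add: powr_mult_base)
  also have "t * (1 + (s - 1) * (1 - 1 / t)) = 1 + s * (t - 1)"
    using t by (simp add: field_simps)
  finally show ?thesis .
qed

text \<open>The first-order condition yields the candidate \<open>h0\<close>. For
  \<open>h = t * h0\<close> the loss in profit is a positive multiple of the gap in Bernoulli's
  inequality at \<open>t\<close>, so \<open>h0\<close> is the only maximizer and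
  \<open>arg_max\<close> must return it.\<close>

lemma seller_quantity_eq:
  assumes "0 < \<alpha>" "0 < q" "0 < k x"
  shows "seller_quantity \<alpha> k x q = (q / k x) powr (1 / \<alpha>)"
proof -
  define h0 where "h0 = (q / k x) powr (1 / \<alpha>)"
  define f where "f = (\<lambda>h. h * q - k x * h powr (\<alpha> + 1) / (\<alpha> + 1))"
  have h0: "0 < h0" using assms by (simp add: h0_def)
  have "h0 powr \<alpha> = q / k x"
    using assms by (simp add: h0_def powr_powr)
  then have foc: "k x * h0 powr (\<alpha> + 1) = q * h0"
    using h0 assms by (simp add: powr_add)
  have less: "f h < f h0" if "0 \<le> h" "h \<noteq> h0" for h
  proof -
    define t where "t = h / h0"
    have t: "0 \<le> t" "t \<noteq> 1" "h = t * h0"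
      using that h0 by (auto simp: t_def)
    have "1 + (\<alpha> + 1) * (t - 1) < t powr (\<alpha> + 1)"
      using t assms by (intro Bernoulli_powr_strict) auto
    then have "0 < q * h0 * (t powr (\<alpha> + 1) - 1 - (\<alpha> + 1) * (t - 1))"
      using assms h0 by simp
    then have "0 < q * h0 * (t powr (\<alpha> + 1) - 1 - (\<alpha> + 1) * (t - 1)) / (\<alpha> + 1)"
      using assms by simp
    also have "\<dots> = f h0 - f h"
    proof -
      have "k x * h powr (\<alpha> + 1) = t powr (\<alpha> + 1) * (q * h0)"
        using t h0 foc by (simp add: powr_mult)
      then have "f h0 - f h
          = q * h0 - q * h0 / (\<alpha> + 1) - (t * (q * h0) - t powr (\<alpha> + 1) * (q * h0) / (\<alpha> + 1))"
        using foc t(3) by (simp add: f_def mult_ac)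
      \<comment> \<open>Here \<open>X\<close>, \<open>Y\<close> and \<open>s\<close> stand for
        \<open>q * h0\<close>, \<open>t powr (\<alpha> + 1)\<close> and
        \<open>\<alpha> + 1\<close>.\<close>
      moreover have "X * (Y - 1 - s * (t - 1)) / s = X - X / s - (t * X - Y * X / s)"
        if "s \<noteq> 0" for X Y s :: real
        using that by (simp add: field_simps)
      ultimately show ?thesis using assms by simp
    qed
    finally show ?thesis by simp
  qed
  have "arg_max f (\<lambda>h. 0 \<le> h) = h0"
  proof (rule arg_maxI[where P = "\<lambda>h. 0 \<le> h" and x = h0])
    show "0 \<le> h0" using h0 by simp
    show "\<not> f y > f h0" if "0 \<le> y" for y
      using less[OF that] by (cases "y = h0") auto
    show "x = h0" if "0 \<le> x" "\<forall>y. 0 \<le> y \<longrightarrow> \<not> f x < f y" for x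
      using that less[of x] h0 by (cases "x = h0") (auto dest: spec[of _ h0])
  qed
  then show ?thesis by (simp add: seller_quantity_def f_def h0_def)
qed

section \<open>Aggregate supply and consistent beliefs\<close>

text \<open>Optimal quantities are homogeneous of degree \<open>1 / \<alpha>\<close> in the price,
  so the price factors out of the integral.\<close>

lemma aggregate_supply_eq:
  assumes "0 < \<alpha>" "0 < q" "\<And>x. x \<in> space \<phi> \<Longrightarrow> 0 < k x"
  shows "aggregate_supply \<phi> \<alpha> k B q = q powr (1 / \<alpha>) * aggregate_supply \<phi> \<alpha> k B 1"
proof -
  have "aggregate_supply \<phi> \<alpha> k B q
      = (LINT x|\<phi>. q powr (1 / \<alpha>) * (indicator B x *\<^sub>R seller_quantity \<alpha> k x 1))"
    unfolding aggregate_supply_def set_lebesgue_integral_def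
    using assms
    by (intro Bochner_Integration.integral_cong refl)
       (simp add: seller_quantity_eq powr_divide less_imp_le)
  then show ?thesis
    by (simp add: aggregate_supply_def set_lebesgue_integral_def)
qed

lemma aggregate_supply_nonneg:
  assumes "0 < \<alpha>" "0 < q" "\<And>x. x \<in> space \<phi> \<Longrightarrow> 0 < k x"
  shows "0 \<le> aggregate_supply \<phi> \<alpha> k B q"
  unfolding aggregate_supply_def set_lebesgue_integral_def
  using assms by (intro Bochner_Integration.integral_nonneg) (simp add: seller_quantity_eq)

text \<open>The price factor cancels in the ratio of supplies. Hence mean qualities are the same at
  all positive prices.\<close>

lemma consistent_belief_cong_price:
  assumes "0 < \<alpha>" "0 < q" "0 < q'" "\<And>x. x \<in> space \<phi> \<Longrightarrow> 0 < k x"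
  shows "consistent_belief \<phi> \<alpha> k B q l \<longleftrightarrow> consistent_belief \<phi> \<alpha> k B q' l"
proof -
  have "aggregate_supply \<phi> \<alpha> k A q / aggregate_supply \<phi> \<alpha> k B q
      = aggregate_supply \<phi> \<alpha> k A q' / aggregate_supply \<phi> \<alpha> k B q'" for A
    using assms aggregate_supply_eq[of \<alpha> q \<phi> k] aggregate_supply_eq[of \<alpha> q' \<phi> k] by simp
  then show ?thesis by (simp add: consistent_belief_def)
qed

lemma consistent_belief_unique:
  assumes "consistent_belief \<phi> \<alpha> k B q l" "consistent_belief \<phi> \<alpha> k B q l'"
  shows "l = l'"
proof (rule measure_eqI)
  show eq: "sets l = sets l'"
    using assms by (simp add: consistent_belief_def)
  interpret l: prob_space l using assms by (simp add: consistent_belief_def)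
  interpret l': prob_space l' using assms by (simp add: consistent_belief_def)
  show "emeasure l A = emeasure l' A" if "A \<in> sets l" for A
    using that assms eq
    by (simp add: l.emeasure_eq_measure l'.emeasure_eq_measure consistent_belief_def)
qed

lemma belief_eqI: "consistent_belief \<phi> \<alpha> k B q l \<Longrightarrow> belief \<phi> \<alpha> k B q = l"
  unfolding belief_def by (blast intro: consistent_belief_unique)

text \<open>
  If the supply vanished, the junk value \<open>x / 0 = 0\<close> would make every consistent belief the zero
  measure.
\<close>

lemma consistent_belief_supply_pos:
  assumes "0 < \<alpha>" "0 < q" "\<And>x. x \<in> space \<phi> \<Longrightarrow> 0 < k x" "consistent_belief \<phi> \<alpha> k B q l"
  shows "0 < aggregate_supply \<phi> \<alpha> k B q"
proof -
  interpret l: prob_space l using assms by (simp add: consistent_belief_def)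
  have "aggregate_supply \<phi> \<alpha> k (space l) q / aggregate_supply \<phi> \<alpha> k B q = 1"
    using assms(4) l.prob_space sets.top[of l] unfolding consistent_belief_def by metis
  then have "aggregate_supply \<phi> \<alpha> k B q \<noteq> 0" by auto
  with aggregate_supply_nonneg[of \<alpha> q \<phi> k B] assms show ?thesis by simp
qed

lemma aggregate_supply_strict_mono:
  assumes "0 < \<alpha>" "\<And>x. x \<in> space \<phi> \<Longrightarrow> 0 < k x" "0 < aggregate_supply \<phi> \<alpha> k B 1"
    and "0 < q" "q < q'"
  shows "aggregate_supply \<phi> \<alpha> k B q < aggregate_supply \<phi> \<alpha> k B q'"
  using assms aggregate_supply_eq[of \<alpha> q \<phi> k B] aggregate_supply_eq[of \<alpha> q' \<phi> k B]
  by (simp add: powr_less_mono2)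

section \<open>Demand as the measure of a set of types\<close>

text \<open>The event whose indicator \<open>demand\<close> integrates, written with mean qualities
  in place of beliefs.\<close>

definition choosers :: "real \<Rightarrow> real \<Rightarrow> real list \<Rightarrow> real list \<Rightarrow> nat \<Rightarrow> real set" where
  "choosers a b es ps i =
     {m \<in> {a..b}. 0 \<le> m * es ! i - ps ! i \<and>
        (\<forall>j<length es. m * es ! j - ps ! j \<le> m * es ! i - ps ! i) \<and>
        (\<forall>j<length es. i < j \<longrightarrow> m * es ! j - ps ! j \<noteq> m * es ! i - ps ! i)}"

lemma choosers_borel [measurable]: "choosers a b es ps i \<in> sets borel"
  unfolding choosers_def by measurable

lemma demand_eq_measure_choosers:
  assumes "sets \<mu> = sets borel" "i < length ls"
  shows "demand a b \<mu> ls ps i = measure \<mu> (choosers a b (map mean_quality ls) ps i)"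
proof -
  have "demand a b \<mu> ls ps i = (LINT m|\<mu>. indicator (choosers a b (map mean_quality ls) ps i) m)"
    unfolding demand_def set_lebesgue_integral_def
    using assms
    by (intro Bochner_Integration.integral_cong refl)
       (auto simp: choosers_def utility_def indicator_def)
  then show ?thesis
    using assms choosers_borel sets_eq_imp_space_eq[OF assms(1)] by simp
qed

lemma disjoint_choosers:
  "disjoint_family_on (choosers a b es ps) {..<length es}"
  unfolding disjoint_family_on_def
proof (intro ballI impI)
  fix i j assume "i \<in> {..<length es}" "j \<in> {..<length es}" "i \<noteq> j"
  then have ij: "i < length es" "j < length es" "i < j \<or> j < i" by auto
  have False if "m \<in> choosers a b es ps i" "m \<in> choosers a b es ps j" for m
  proof -
    have "m * es ! j - ps ! j = m * es ! i - ps ! i"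
      using that ij unfolding choosers_def by (intro antisym) auto
    with that ij show False unfolding choosers_def by auto
  qed
  then show "choosers a b es ps i \<inter> choosers a b es ps j = {}" by blast
qed

text \<open>The chosen set is the one with the largest index among the finitely many utility
  maximizers, as the tie-breaking rule demands.\<close>

lemma choosers_cover:
  assumes "m \<in> {a..b}" "i < length es" "0 \<le> m * es ! i - ps ! i"
  obtains j where "j < length es" "m \<in> choosers a b es ps j"
    "m * es ! i - ps ! i \<le> m * es ! j - ps ! j"
proof -
  define v where "v = (\<lambda>j. m * es ! j - ps ! j)"
  define A where "A = {j. j < length es \<and> (\<forall>r<length es. v r \<le> v j)}"
  have "finite A" by (simp add: A_def)
  have "Max (v ` {..<length es}) \<in> v ` {..<length es}"
    using assms(2) by (intro Max_in) auto
  then obtain j0 where "j0 < length es" "v j0 = Max (v ` {..<length es})" by auto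
  then have "j0 \<in> A" by (auto simp: A_def)
  define j where "j = Max A"
  have j: "j \<in> A" "\<And>r. r \<in> A \<Longrightarrow> r \<le> j"
    using \<open>finite A\<close> \<open>j0 \<in> A\<close> Max_in[of A] Max_ge[of A] unfolding j_def by blast+
  have ge: "v i \<le> v j" using j assms(2) by (simp add: A_def)
  have "v r \<noteq> v j" if "r < length es" "j < r" for r
    using j(1) j(2)[of r] that by (auto simp: A_def)
  then have "m \<in> choosers a b es ps j"
    using j ge assms(1,3) by (auto simp: choosers_def A_def v_def)
  with j ge show ?thesis by (intro that[of j]) (auto simp: A_def v_def)
qed

section \<open>Uniqueness of equilibrium prices\<close>

text \<open>
  Gross substitutes: on the sets whose price is higher under \<open>ps\<close> than under \<open>ps'\<close> the total supply
  is higher too, but every buyer choosing one of these sets at \<open>ps\<close> also chooses one of them at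
  \<open>ps'\<close>.
\<close>

lemma equilibrium_prices_le:
  assumes "0 < \<alpha>" "\<And>x. x \<in> space \<phi> \<Longrightarrow> 0 < k x" "real_distribution \<mu>"
    and eq: "equilibrium \<phi> \<alpha> k a b \<mu> Bs ps ls" and eq': "equilibrium \<phi> \<alpha> k a b \<mu> Bs ps' ls'"
    and "i < length Bs"
  shows "ps ! i \<le> ps' ! i"
proof (rule ccontr)
  assume "\<not> ps ! i \<le> ps' ! i"
  interpret real_distribution \<mu> by fact
  define es where "es = map mean_quality ls"
  define U where "U = {j. j < length Bs \<and> ps' ! j < ps ! j}"
  have U: "finite U" "U \<noteq> {}"
    using assms(6) \<open>\<not> ps ! i \<le> ps' ! i\<close> by (auto simp: U_def)
  have len: "length es = length Bs" "length ls = length Bs" "length ls' = length Bs"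
    using eq eq' by (auto simp: equilibrium_def es_def)
  have pos: "0 < ps ! j" "0 < ps' ! j" if "j < length Bs" for j
    using eq eq' that by (auto simp: equilibrium_def)
  have cb: "consistent_belief \<phi> \<alpha> k (Bs ! j) (ps ! j) (ls ! j)"
    "consistent_belief \<phi> \<alpha> k (Bs ! j) (ps' ! j) (ls' ! j)" if "j < length Bs" for j
    using eq eq' that by (auto simp: equilibrium_def)
  \<comment> \<open>Beliefs do not depend on prices, so both demands are governed by the same mean
    qualities \<open>es\<close>.\<close>
  have "ls ! j = ls' ! j" if "j < length Bs" for j
    using cb[OF that] consistent_belief_cong_price[of \<alpha> "ps ! j" "ps' ! j" \<phi> k] assms pos[OF that]
    by (auto intro: consistent_belief_unique)
  then have "ls' = ls" by (intro nth_equalityI) (auto simp: len)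
  have D: "aggregate_supply \<phi> \<alpha> k (Bs ! j) (ps ! j) = measure \<mu> (choosers a b es ps j)"
    "aggregate_supply \<phi> \<alpha> k (Bs ! j) (ps' ! j) = measure \<mu> (choosers a b es ps' j)"
    if "j < length Bs" for j
    using eq eq' that demand_eq_measure_choosers[of \<mu> j ls] len
    by (simp_all add: equilibrium_def es_def \<open>ls' = ls\<close>)
  have U_sub: "U \<subseteq> {..<length es}" by (auto simp: U_def len)
  have sum_eq: "(\<Sum>j\<in>U. measure \<mu> (choosers a b es q j)) = measure \<mu> (\<Union>j\<in>U. choosers a b es q j)"
    for q
    using U disjoint_family_on_mono[OF U_sub disjoint_choosers]
    by (intro finite_measure_finite_Union[symmetric]) auto
  have "(\<Sum>j\<in>U. measure \<mu> (choosers a b es ps' j)) < (\<Sum>j\<in>U. measure \<mu> (choosers a b es ps j))"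
  proof (rule sum_strict_mono[OF U])
    fix j assume "j \<in> U"
    then have j: "j < length Bs" "ps' ! j < ps ! j" by (auto simp: U_def)
    have "0 < aggregate_supply \<phi> \<alpha> k (Bs ! j) 1"
      using consistent_belief_cong_price[of \<alpha> "ps ! j" 1 \<phi> k] pos[OF j(1)] cb(1)[OF j(1)] assms
        consistent_belief_supply_pos[of \<alpha> 1 \<phi> k "Bs ! j" "ls ! j"] by simp
    then show "measure \<mu> (choosers a b es ps' j) < measure \<mu> (choosers a b es ps j)"
      using aggregate_supply_strict_mono[of \<alpha> \<phi> k "Bs ! j" "ps' ! j" "ps ! j"] assms j pos D
      by simp
  qed
  moreover have "(\<Union>j\<in>U. choosers a b es ps j) \<subseteq> (\<Union>j\<in>U. choosers a b es ps' j)"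
  proof
    fix m assume "m \<in> (\<Union>j\<in>U. choosers a b es ps j)"
    then obtain i where i: "i \<in> U" "m \<in> choosers a b es ps i" by auto
    then have *: "i < length es" "ps' ! i < ps ! i" "m \<in> {a..b}" "0 \<le> m * es ! i - ps ! i"
      by (auto simp: U_def len choosers_def)
    then obtain j where j: "j < length es" "m \<in> choosers a b es ps' j"
        "m * es ! i - ps' ! i \<le> m * es ! j - ps' ! j"
      using choosers_cover[of m a b i es ps'] by auto
    have "m * es ! j - ps ! j \<le> m * es ! i - ps ! i"
      using i(2) j(1) by (simp add: choosers_def)
    \<comment> \<open>Adding the two utility comparisons gives
      \<open>ps ! i - ps' ! i \<le> ps ! j - ps' ! j\<close>, and the left side is positive.\<close>
    then have "j \<in> U" using * j by (simp add: U_def len)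
    with j show "m \<in> (\<Union>j\<in>U. choosers a b es ps' j)" by auto
  qed
  then have "measure \<mu> (\<Union>j\<in>U. choosers a b es ps j) \<le> measure \<mu> (\<Union>j\<in>U. choosers a b es ps' j)"
    using U by (intro finite_measure_mono) auto
  ultimately show False by (simp add: sum_eq)
qed

text \<open>Comparing two equilibria in both directions shows that prices are unique, so the
  definite description denotes \<open>ps\<close>. Market clearing then collapses the minimum of
  demand and supply.\<close>

lemma equilibrium_revenue_eq:
  assumes "0 < \<alpha>" "\<And>x. x \<in> space \<phi> \<Longrightarrow> 0 < k x" "real_distribution \<mu>"
    and eq: "equilibrium \<phi> \<alpha> k a b \<mu> Bs ps ls"
  shows "equilibrium_revenue \<phi> \<alpha> k a b \<mu> Bs = (\<Sum>i<length Bs. ps ! i * demand a b \<mu> ls ps i)"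
    and "beliefs \<phi> \<alpha> k Bs ps = ls"
proof -
  show ls: "beliefs \<phi> \<alpha> k Bs ps = ls"
    using eq by (intro nth_equalityI) (auto simp: equilibrium_def beliefs_def intro!: belief_eqI)
  have "(THE ps. implementable \<phi> \<alpha> k a b \<mu> Bs ps) = ps"
  proof (rule the_equality)
    show "implementable \<phi> \<alpha> k a b \<mu> Bs ps" using eq by (auto simp: implementable_def)
    show "ps' = ps" if imp: "implementable \<phi> \<alpha> k a b \<mu> Bs ps'" for ps'
    proof -
      obtain ls' where eq': "equilibrium \<phi> \<alpha> k a b \<mu> Bs ps' ls'"
        using imp by (auto simp: implementable_def)
      have "ps' ! i = ps ! i" if "i < length Bs" for i
        using equilibrium_prices_le[OF assms(1-3) eq eq' that]
          equilibrium_prices_le[OF assms(1-3) eq' eq that] by simp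
      then show ?thesis
        using eq eq' by (intro nth_equalityI) (auto simp: equilibrium_def)
    qed
  qed
  then show "equilibrium_revenue \<phi> \<alpha> k a b \<mu> Bs = (\<Sum>i<length Bs. ps ! i * demand a b \<mu> ls ps i)"
    using eq unfolding equilibrium_revenue_def revenue_def
    by (auto simp: ls equilibrium_def intro!: sum.cong)
qed

section \<open>Threshold types\<close>

text \<open>The type indifferent between options \<open>i\<close> and \<open>Suc i\<close>. Counting
  starts at 0, so this is \<open>T\<^sub>i\<^sub>+\<^sub>1\<close> in the notation of the
  outline.\<close>

definition threshold :: "(nat \<Rightarrow> real) \<Rightarrow> (nat \<Rightarrow> real) \<Rightarrow> nat \<Rightarrow> real" where
  "threshold e p i = (p (Suc i) - p i) / (e (Suc i) - e i)"

lemma utility_step: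
  assumes "e i < e (Suc i)"
  shows "(m * e (Suc i) - p (Suc i)) - (m * e i - p i) = (m - threshold e p i) * (e (Suc i) - e i)"
proof -
  have "threshold e p i * (e (Suc i) - e i) = p (Suc i) - p i"
    using assms by (simp add: threshold_def)
  then show ?thesis by (simp add: algebra_simps)
qed

lemma utility_step_iff:
  assumes "e i < e (Suc i)"
  shows "m * e i - p i \<le> m * e (Suc i) - p (Suc i) \<longleftrightarrow> threshold e p i \<le> m"
    and "m * e (Suc i) - p (Suc i) < m * e i - p i \<longleftrightarrow> m < threshold e p i"
proof -
  show 1: "m * e i - p i \<le> m * e (Suc i) - p (Suc i) \<longleftrightarrow> threshold e p i \<le> m"
    using utility_step[of e i m p] assms zero_le_mult_iff[of "m - threshold e p i" "e (Suc i) - e i"]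
    by linarith
  show "m * e (Suc i) - p (Suc i) < m * e i - p i \<longleftrightarrow> m < threshold e p i"
    using 1 by linarith
qed

text \<open>Not buying is treated as an option of index 0 with mean quality and price 0.\<close>

context
  fixes es ps :: "real list" and e p :: "nat \<Rightarrow> real" and n :: nat
  defines "e \<equiv> (!) (0 # es)" and "p \<equiv> (!) (0 # ps)" and "n \<equiv> length es"
  assumes e_less: "\<And>i. i < n \<Longrightarrow> e i < e (Suc i)"
begin

text \<open>List position \<open>i\<close> is option \<open>Suc i\<close>, and only its two
  neighbouring options are compared with it. The upper bound is strict because ties go to the higher
  index.\<close>

lemma choosers_imp_threshold:
  assumes "i < n" "m \<in> choosers a b es ps i"
  shows "threshold e p i \<le> m" and "Suc i < n \<Longrightarrow> m < threshold e p (Suc i)"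
proof -
  have "m * e i - p i \<le> m * e (Suc i) - p (Suc i)"
    using assms by (cases i) (auto simp: choosers_def e_def p_def n_def)
  then show "threshold e p i \<le> m"
    using utility_step_iff(1)[of e i] e_less[OF assms(1)] by simp
  assume "Suc i < n"
  then have "m * e (Suc (Suc i)) - p (Suc (Suc i)) < m * e (Suc i) - p (Suc i)"
    using assms by (auto simp: choosers_def e_def p_def n_def order_less_le)
  then show "m < threshold e p (Suc i)"
    using utility_step_iff(2)[of e "Suc i"] e_less[OF \<open>Suc i < n\<close>] by simp
qed

text \<open>Any type choosing position \<open>i\<close> separates the two thresholds.\<close>

lemma threshold_less_Suc:
  assumes "choosers a b es ps i \<noteq> {}" "Suc i < n"
  shows "threshold e p i < threshold e p (Suc i)"
  using assms choosers_imp_threshold[of i] by (metis Suc_lessD ex_in_conv le_less_trans)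

lemma threshold_mono:
  assumes "\<And>i. i < n \<Longrightarrow> choosers a b es ps i \<noteq> {}" "i \<le> j" "j < n"
  shows "threshold e p i \<le> threshold e p j"
  using assms(2,3)
proof (induction j rule: dec_induct)
  case (step j)
  then show ?case using threshold_less_Suc[of a b j] assms(1)[of j] by simp
qed simp

text \<open>Since thresholds increase, the utility of a fixed type rises along the options up to
  \<open>Suc i\<close> and strictly falls afterwards. Comparisons with neighbours therefore decide
  the global choice.\<close>

lemma choosers_eq_threshold:
  assumes nonempty: "\<And>i. i < n \<Longrightarrow> choosers a b es ps i \<noteq> {}" and "i < n"
  shows "choosers a b es ps i =
    {a..b} \<inter> (if Suc i < n then {threshold e p i..<threshold e p (Suc i)} else {threshold e p i..})"
proof
  show "choosers a b es ps i \<subseteq>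
    {a..b} \<inter> (if Suc i < n then {threshold e p i..<threshold e p (Suc i)} else {threshold e p i..})"
    using choosers_imp_threshold[OF \<open>i < n\<close>] by (auto simp: choosers_def)
  show "{a..b} \<inter> (if Suc i < n then {threshold e p i..<threshold e p (Suc i)} else {threshold e p i..})
    \<subseteq> choosers a b es ps i"
  proof
    fix m
    assume m: "m \<in> {a..b} \<inter>
      (if Suc i < n then {threshold e p i..<threshold e p (Suc i)} else {threshold e p i..})"
    then have ge: "threshold e p i \<le> m" by (auto split: if_splits)
    have less: "m < threshold e p j" if "i < j" "j < n" for j
    proof -
      have "m < threshold e p (Suc i)" using m that by (auto split: if_splits)
      also have "\<dots> \<le> threshold e p j" using threshold_mono[OF nonempty] that by simp
      finally show ?thesis .
    qed
    define u where "u = (\<lambda>j. m * e j - p j)"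
    have step_up: "u j \<le> u (Suc j)" if "j \<le> i" for j
    proof -
      have "threshold e p j \<le> threshold e p i" using threshold_mono[OF nonempty] that \<open>i < n\<close> by simp
      then show ?thesis using utility_step_iff(1)[of e j m p] e_less[of j] ge that \<open>i < n\<close>
        by (simp add: u_def)
    qed
    have up: "u j \<le> u (Suc i)" if "j \<le> Suc i" for j
      using that
    proof (induction j rule: inc_induct)
      case (step j)
      then show ?case using step_up[of j] by simp
    qed simp
    have step_down: "u (Suc j) < u j" if "i < j" "j < n" for j
      using utility_step_iff(2)[of e j m p] e_less[of j] less[of j] that by (simp add: u_def)
    have down: "u j < u (Suc i)" if "Suc i < j" "j \<le> n" for j
      using that(1)[THEN Suc_leI] that(2)
    proof (induction j rule: dec_induct)
      case base
      then show ?case using step_down[of "Suc i"] by simp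
    next
      case (step j)
      then show ?case using step_down[of j] by simp
    qed
    have "u 0 = 0" by (simp add: u_def e_def p_def)
    have u_Suc: "m * es ! j - ps ! j = u (Suc j)" for j by (simp add: u_def e_def p_def)
    have "0 \<le> u (Suc i)" using up[of 0] \<open>u 0 = 0\<close> by simp
    moreover have "u (Suc j) \<le> u (Suc i)" if "j < n" for j
      using up[of "Suc j"] down[of "Suc j"] that by (cases "j \<le> i") auto
    moreover have "u (Suc j) \<noteq> u (Suc i)" if "j < n" "i < j" for j
      using down[of "Suc j"] that by simp
    ultimately show "m \<in> choosers a b es ps i"
      using m unfolding choosers_def mem_Collect_eq u_Suc n_def by auto
  qed
qed

end

section \<open>Summation identities\<close>

lemma sum_by_parts:
  fixes p H :: "nat \<Rightarrow> real"
  assumes "p 0 = 0"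
  shows "(\<Sum>i<n. p (Suc i) * (H (Suc i) - H i)) = p n * H n - (\<Sum>i<n. H i * (p (Suc i) - p i))"
  using assms by (induction n) (auto simp: algebra_simps)

lemma threshold_average:
  assumes "\<And>i. i < n \<Longrightarrow> e i < e (Suc i)" "p 0 = 0"
  shows "(\<Sum>i<n. (e (Suc i) - e i) * threshold e p i) = p n"
proof -
  have "(e (Suc i) - e i) * threshold e p i = p (Suc i) - p i" if "i < n" for i
    using assms(1)[OF that] by (simp add: threshold_def)
  then show ?thesis
    using sum_lessThan_telescope[of p n] assms(2) by simp
qed

section \<open>Distribution of the buyers' types\<close>

lemma buyer_distribution_AE:
  assumes "buyer_distribution a b \<mu>"
  shows "AE m in \<mu>. m \<in> {a..b}" "AE m in \<mu>. m \<noteq> x"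
proof -
  obtain f where f: "continuous_on {a..b} f"
    and mu: "\<mu> = density lborel (\<lambda>m. ennreal (f m) * indicator {a..b} m)"
    using assms by (auto simp: buyer_distribution_def)
  \<comment> \<open>Continuity of \<open>f\<close> is known only on \<open>{a..b}\<close>, so
    measurability is derived for its truncation to that interval.\<close>
  have "(\<lambda>m. indicator {a..b} m *\<^sub>R f m) \<in> borel_measurable borel"
    using f by (intro borel_measurable_continuous_on_indicator) auto
  then have "(\<lambda>m. ennreal (indicator {a..b} m *\<^sub>R f m)) \<in> borel_measurable borel"
    by measurable
  also have "(\<lambda>m. ennreal (indicator {a..b} m *\<^sub>R f m)) = (\<lambda>m. ennreal (f m) * indicator {a..b} m)"
    by (auto simp: indicator_def)
  finally have meas: "(\<lambda>m. ennreal (f m) * indicator {a..b} m) \<in> borel_measurable lborel" by simp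
  show "AE m in \<mu>. m \<in> {a..b}"
    unfolding mu AE_density[OF meas] by (auto simp: indicator_def)
  show "AE m in \<mu>. m \<noteq> x"
    unfolding mu AE_density[OF meas] using AE_lborel_singleton[of x] by (auto elim: eventually_mono)
qed

context
  fixes a b :: real and \<mu> :: "real measure"
  assumes buyers: "buyer_distribution a b \<mu>"
begin

interpretation real_distribution \<mu>
  using buyers by (simp add: buyer_distribution_def)

lemma ab: "0 \<le> a" "a < b"
  using buyers by (auto simp: buyer_distribution_def)

lemma isCont_cdf_buyers: "isCont (cdf \<mu>) x"
proof -
  have "measure \<mu> {x} = 0"
    using prob_eq_0[of "{x}"] buyer_distribution_AE(2)[OF buyers, of x] by simp
  then show ?thesis by (simp add: isCont_cdf)
qed

lemma cdf_below: "x \<le> a \<Longrightarrow> cdf \<mu> x = 0"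
proof -
  assume "x \<le> a"
  have "AE m in \<mu>. m \<notin> {..x}"
    using buyer_distribution_AE(1)[OF buyers] buyer_distribution_AE(2)[OF buyers, of a]
    by eventually_elim (use \<open>x \<le> a\<close> in auto)
  then show ?thesis using prob_eq_0[of "{..x}"] by (simp add: cdf_def)
qed

lemma cdf_above: "b \<le> x \<Longrightarrow> cdf \<mu> x = 1"
  unfolding cdf_def using prob_eq_1[of "{..x}"] buyer_distribution_AE(1)[OF buyers]
  by (auto elim: eventually_mono)

lemma cdf_less_1: "x < b \<Longrightarrow> cdf \<mu> x < 1"
proof -
  assume "x < b"
  \<comment> \<open>Strict monotonicity holds on \<open>{a..b}\<close>, so a point below
    \<open>a\<close> is first moved up to \<open>a\<close>.\<close>
  have "cdf \<mu> x \<le> cdf \<mu> (max a x)" by (intro cdf_nondecreasing) auto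
  also have "\<dots> < cdf \<mu> b"
    using buyers \<open>x < b\<close> by (auto simp: buyer_distribution_def intro: strict_mono_onD)
  finally show ?thesis by (simp add: cdf_above)
qed

text \<open>The law has no atoms and no mass outside \<open>{a..b}\<close>, so including the type
  \<open>t\<close> itself changes nothing.\<close>

lemma measure_types_atLeast: "measure \<mu> ({a..b} \<inter> {t..}) = 1 - cdf \<mu> t"
proof -
  have "measure \<mu> ({a..b} \<inter> {t..}) = measure \<mu> (space \<mu> - {..t})"
    by (rule finite_measure_eq_AE)
       (use buyer_distribution_AE(1)[OF buyers] buyer_distribution_AE(2)[OF buyers, of t] in
         \<open>auto elim!: eventually_elim2\<close>)
  then show ?thesis using prob_compl[of "{..t}"] by (simp add: cdf_def del: Int_atLeastAtMost)
qed

lemma measure_types_atLeastLessThan: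
  "t \<le> t' \<Longrightarrow> measure \<mu> ({a..b} \<inter> {t..<t'}) = cdf \<mu> t' - cdf \<mu> t"
proof -
  assume "t \<le> t'"
  have "{a..b} \<inter> {t..<t'} = ({a..b} \<inter> {t..}) - ({a..b} \<inter> {t'..})" using \<open>t \<le> t'\<close> by auto
  moreover have "measure \<mu> (({a..b} \<inter> {t..}) - ({a..b} \<inter> {t'..}))
      = measure \<mu> ({a..b} \<inter> {t..}) - measure \<mu> ({a..b} \<inter> {t'..})"
    using \<open>t \<le> t'\<close> by (intro finite_measure_Diff) auto
  ultimately show ?thesis by (simp only: measure_types_atLeast)
qed

lemma demand_single:
  assumes "0 < mean_quality l"
  shows "demand a b \<mu> [l] [q] 0 = 1 - cdf \<mu> (q / mean_quality l)"
proof -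
  have "choosers a b [mean_quality l] [q] 0 = {a..b} \<inter> {q / mean_quality l..}"
    using assms by (auto simp: choosers_def field_simps)
  then show ?thesis
    using measure_types_atLeast by (simp add: demand_eq_measure_choosers)
qed

section \<open>Monopoly price and shape of the revenue from one set\<close>

text \<open>\<open>arg_max\<close> is informative only if a maximizer exists. The revenue is
  continuous, nonnegative and zero from \<open>b * e\<close> on, so its maximum over
  \<open>{0..b * e}\<close> is global; it is positive at \<open>(a + b) / 2 * e\<close>, which
  excludes the price 0.\<close>

lemma monopoly_price:
  assumes "0 < e"
  shows "0 < monopoly_price \<mu> e"
    and "0 \<le> q \<Longrightarrow> q * (1 - cdf \<mu> (q / e))
           \<le> monopoly_price \<mu> e * (1 - cdf \<mu> (monopoly_price \<mu> e / e))"
proof -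
  define R where "R = (\<lambda>q. q * (1 - cdf \<mu> (q / e)))"
  have "continuous_on {0..b * e} R"
    unfolding R_def
    by (intro continuous_intros continuous_at_imp_continuous_on ballI
          isCont_o2[OF _ isCont_cdf_buyers]) (use assms in auto)
  moreover have "{0..b * e} \<noteq> {}" using ab assms by simp
  ultimately obtain z where z: "z \<in> {0..b * e}" "\<And>y. y \<in> {0..b * e} \<Longrightarrow> R y \<le> R z"
    using continuous_attains_sup[of "{0..b * e}" R] by auto
  have R_nonneg: "0 \<le> R y" if "0 \<le> y" for y
    using that cdf_bounded_prob[of "y / e"] by (simp add: R_def)
  have max: "R y \<le> R z" if "0 \<le> y" for y
  proof (cases "y \<le> b * e")
    case False
    then have "R y = 0" using assms by (simp add: R_def cdf_above field_simps)
    then show ?thesis using R_nonneg[of z] z by simp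
  qed (use z that in auto)
  have "is_arg_max R (\<lambda>q. 0 \<le> q) z"
    using z max by (force simp: is_arg_max_def)
  then have am: "is_arg_max R (\<lambda>q. 0 \<le> q) (monopoly_price \<mu> e)"
    unfolding monopoly_price_def R_def[symmetric] arg_max_def by (rule someI)
  then have le: "R y \<le> R (monopoly_price \<mu> e)" if "0 \<le> y" for y
    using that by (force simp: is_arg_max_def)
  have "0 < R ((a + b) / 2 * e)"
    using ab assms cdf_less_1[of "(a + b) / 2"] by (simp add: R_def)
  then have "0 < R (monopoly_price \<mu> e)"
    using le[of "(a + b) / 2 * e"] ab assms by simp
  then show "0 < monopoly_price \<mu> e"
    using am by (cases "monopoly_price \<mu> e = 0") (auto simp: R_def is_arg_max_def)
  show "0 \<le> q \<Longrightarrow> q * (1 - cdf \<mu> (q / e))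
           \<le> monopoly_price \<mu> e * (1 - cdf \<mu> (monopoly_price \<mu> e / e))"
    using le by (simp add: R_def)
qed

text \<open>The maximizer \<open>z\<close> lies in \<open>{a..b}\<close>, where quasi-concavity
  gives monotonicity on either side of it. Outside, the function is explicit: the identity below
  \<open>a\<close> and zero above \<open>b\<close>.\<close>

lemma revenue_unimodal:
  assumes quasi: "strictly_quasi_concave_on {a..b} (\<lambda>m. m * (1 - cdf \<mu> m))"
    and max: "\<And>x. 0 \<le> x \<Longrightarrow> x * (1 - cdf \<mu> x) \<le> z * (1 - cdf \<mu> z)"
    and "0 \<le> z"
  shows "\<lbrakk>0 \<le> x; x \<le> y; y \<le> z\<rbrakk> \<Longrightarrow> x * (1 - cdf \<mu> x) \<le> y * (1 - cdf \<mu> y)"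
    and "\<lbrakk>z \<le> x; x \<le> y\<rbrakk> \<Longrightarrow> y * (1 - cdf \<mu> y) \<le> x * (1 - cdf \<mu> x)"
proof -
  define r where "r = (\<lambda>m. m * (1 - cdf \<mu> m))"
  have r_below: "r x = x" if "x \<le> a" for x using that by (simp add: r_def cdf_below)
  have r_above: "r x = 0" if "b \<le> x" for x using that by (simp add: r_def cdf_above)
  have r_nonneg: "0 \<le> r x" if "0 \<le> x" for x
    using that cdf_bounded_prob[of x] by (simp add: r_def)
  have max': "r x \<le> r z" if "0 \<le> x" for x using max[OF that] by (simp add: r_def)
  have "a \<le> z"
  proof (rule ccontr)
    assume "\<not> a \<le> z"
    then show False using max'[of a] r_below[of z] r_below[of a] ab by simp
  qed
  moreover have "z < b"
  proof (rule ccontr)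
    assume "\<not> z < b"
    moreover have "0 < r ((a + b) / 2)"
      using ab cdf_less_1[of "(a + b) / 2"] by (simp add: r_def)
    ultimately show False using max'[of "(a + b) / 2"] r_above[of z] ab by simp
  qed
  ultimately have z: "z \<in> {a..b}" by simp
  \<comment> \<open>Below, one endpoint is always the maximizer \<open>z\<close>, so the minimum is
    the value at the other endpoint.\<close>
  have between: "min (r x) (r w) < r y" if "x \<in> {a..b}" "w \<in> {a..b}" "x < y" "y < w" for x y w
  proof -
    define t where "t = (y - x) / (w - x)"
    have "t \<in> {0<..<1}" using that by (simp add: t_def)
    moreover have "(1 - t) * x + t * w = y"
    proof -
      have "t * (w - x) = y - x" using that by (simp add: t_def)
      then show ?thesis by (simp add: algebra_simps)
    qed
    ultimately show ?thesis
      using quasi that unfolding strictly_quasi_concave_on_def r_def by force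
  qed
  have inc: "r x \<le> r y" if "a \<le> x" "x \<le> y" "y \<le> z" for x y
  proof (cases "x = y \<or> y = z")
    case True
    then show ?thesis using max'[of x] that ab by auto
  next
    case False
    then show ?thesis using between[of x z y] max'[of x] that z ab by auto
  qed
  show "x * (1 - cdf \<mu> x) \<le> y * (1 - cdf \<mu> y)" if "0 \<le> x" "x \<le> y" "y \<le> z" for x y
  proof -
    consider "y \<le> a" | "x \<le> a" "a \<le> y" | "a \<le> x" using that by linarith
    then have "r x \<le> r y"
    proof cases
      case 1
      then show ?thesis using that by (simp add: r_below)
    next
      case 2
      then show ?thesis using inc[of a y] that by (simp add: r_below)
    next
      case 3
      then show ?thesis using inc that by simp
    qed
    then show ?thesis by (simp add: r_def)
  qed
  show "y * (1 - cdf \<mu> y) \<le> x * (1 - cdf \<mu> x)" if "z \<le> x" "x \<le> y" for x y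
  proof -
    have "r y \<le> r x"
    proof (cases "b \<le> y \<or> x = y \<or> x = z")
      case True
      then show ?thesis
        using r_above[of y] r_nonneg[of x] max'[of y] that assms(3) by auto
    next
      case False
      then show ?thesis using between[of z y x] max'[of y] that z ab by auto
    qed
    then show ?thesis by (simp add: r_def)
  qed
qed

section \<open>Revenue and market clearing\<close>

text \<open>The demand for the last set is recorded separately, for the later comparison with its
  demand when sold alone.\<close>

lemma threshold_revenue:
  fixes es ps :: "real list" and e p :: "nat \<Rightarrow> real" and n :: nat
  defines "e \<equiv> (!) (0 # es)" and "p \<equiv> (!) (0 # ps)" and "n \<equiv> length es"
  assumes e_less: "\<And>i. i < n \<Longrightarrow> e i < e (Suc i)"
    and nonempty: "\<And>i. i < n \<Longrightarrow> choosers a b es ps i \<noteq> {}" and "0 < n"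
  shows "(\<Sum>i<n. ps ! i * measure \<mu> (choosers a b es ps i))
      = p n - (\<Sum>i<n. (e (Suc i) - e i) * (cdf \<mu> (threshold e p i) * threshold e p i))"
    and "measure \<mu> (choosers a b es ps (n - 1)) = 1 - cdf \<mu> (threshold e p (n - 1))"
proof -
  \<comment> \<open>The value 1 at index \<open>n\<close> plays the part of a threshold above all
    types, so the last set is covered by the same difference formula.\<close>
  define H where "H = (\<lambda>i. if i < n then cdf \<mu> (threshold e p i) else 1)"
  note ch = choosers_eq_threshold[where es = es and ps = ps, folded e_def p_def n_def, OF e_less nonempty]
  note mono = threshold_mono[where es = es and ps = ps, folded e_def p_def n_def, OF e_less nonempty]
  have D: "measure \<mu> (choosers a b es ps i) = H (Suc i) - H i" if "i < n" for i
  proof (cases "Suc i < n")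
    case True
    then have "choosers a b es ps i = {a..b} \<inter> {threshold e p i..<threshold e p (Suc i)}"
      using ch[of i] that by simp
    moreover have "threshold e p i \<le> threshold e p (Suc i)" using mono[of i "Suc i"] True by simp
    ultimately show ?thesis
      using True that measure_types_atLeastLessThan by (simp only: H_def) simp
  next
    case False
    then have "choosers a b es ps i = {a..b} \<inter> {threshold e p i..}"
      using ch[of i] that by simp
    then show ?thesis
      using False that measure_types_atLeast[of "threshold e p i"] by (simp only: H_def) simp
  qed
  show "measure \<mu> (choosers a b es ps (n - 1)) = 1 - cdf \<mu> (threshold e p (n - 1))"
    using D[of "n - 1"] \<open>0 < n\<close> by (simp add: H_def)
  have "(\<Sum>i<n. ps ! i * measure \<mu> (choosers a b es ps i)) = (\<Sum>i<n. p (Suc i) * (H (Suc i) - H i))"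
    using D by (simp add: p_def)
  also have "\<dots> = p n * H n - (\<Sum>i<n. H i * (p (Suc i) - p i))"
    by (rule sum_by_parts) (simp add: p_def)
  also have "(\<Sum>i<n. H i * (p (Suc i) - p i))
      = (\<Sum>i<n. (e (Suc i) - e i) * (cdf \<mu> (threshold e p i) * threshold e p i))"
  proof (rule sum.cong)
    fix i assume "i \<in> {..<n}"
    then have "(e (Suc i) - e i) * threshold e p i = p (Suc i) - p i"
      using e_less[of i] by (simp add: threshold_def)
    then show "H i * (p (Suc i) - p i)
        = (e (Suc i) - e i) * (cdf \<mu> (threshold e p i) * threshold e p i)"
      using \<open>i \<in> {..<n}\<close> by (simp add: H_def mult_ac)
  qed simp
  finally show "(\<Sum>i<n. ps ! i * measure \<mu> (choosers a b es ps i))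
      = p n - (\<Sum>i<n. (e (Suc i) - e i) * (cdf \<mu> (threshold e p i) * threshold e p i))"
    by (simp add: H_def)
qed

text \<open>Intermediate value theorem for the excess supply \<open>f\<close>: at price 0 there is
  no supply and full demand, at \<open>b * e\<close> there is no demand.\<close>

lemma single_equilibrium:
  assumes "0 < \<alpha>" "\<And>x. x \<in> space \<phi> \<Longrightarrow> 0 < k x"
    and l: "consistent_belief \<phi> \<alpha> k B 1 l" and e: "0 < mean_quality l"
  obtains q where "0 < q" "aggregate_supply \<phi> \<alpha> k B q = 1 - cdf \<mu> (q / mean_quality l)"
    "equilibrium_revenue \<phi> \<alpha> k a b \<mu> [B] = q * (1 - cdf \<mu> (q / mean_quality l))"
proof -
  define e where "e = mean_quality l"
  define s where "s = aggregate_supply \<phi> \<alpha> k B 1"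
  have "0 < e" using assms by (simp add: e_def)
  have "0 < s" using consistent_belief_supply_pos[of \<alpha> 1 \<phi> k B l] assms by (simp add: s_def)
  define f where "f = (\<lambda>q. q powr (1 / \<alpha>) * s - (1 - cdf \<mu> (q / e)))"
  have "continuous_on {0..b * e} (\<lambda>q. q powr (1 / \<alpha>))"
    using \<open>0 < \<alpha>\<close> by (intro continuous_on_powr' continuous_intros) auto
  moreover have "continuous_on {0..b * e} (\<lambda>q. cdf \<mu> (q / e))"
    by (intro continuous_at_imp_continuous_on ballI isCont_o2[OF _ isCont_cdf_buyers])
       (use \<open>0 < e\<close> in auto)
  ultimately have "continuous_on {0..b * e} f"
    unfolding f_def by (intro continuous_on_diff continuous_on_mult continuous_on_const)
  moreover have f0: "f 0 = -1" using ab by (simp add: f_def cdf_below)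
  moreover have "0 \<le> f (b * e)" using \<open>0 < e\<close> \<open>0 < s\<close> by (simp add: f_def cdf_above)
  moreover have "0 \<le> b * e" using ab \<open>0 < e\<close> by simp
  ultimately obtain q where q: "0 \<le> q" "f q = 0" using IVT'[of f 0 0 "b * e"] by auto
  then have "0 < q" using f0 by (cases "q = 0") auto
  have S: "aggregate_supply \<phi> \<alpha> k B q = 1 - cdf \<mu> (q / e)"
    using aggregate_supply_eq[of \<alpha> q \<phi> k B] q \<open>0 < q\<close> assms by (simp add: f_def s_def)
  have "consistent_belief \<phi> \<alpha> k B q l"
    using consistent_belief_cong_price[of \<alpha> 1 q \<phi> k] l \<open>0 < q\<close> assms by simp
  then have "equilibrium \<phi> \<alpha> k a b \<mu> [B] [q] [l]"
    using S \<open>0 < q\<close> \<open>0 < e\<close> demand_single[of l q] by (simp add: equilibrium_def e_def)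
  from equilibrium_revenue_eq(1)[OF assms(1,2) real_distribution_axioms this]
  have "equilibrium_revenue \<phi> \<alpha> k a b \<mu> [B] = q * (1 - cdf \<mu> (q / e))"
    using demand_single[of l q] \<open>0 < e\<close> by (simp add: e_def)
  with S \<open>0 < q\<close> show ?thesis by (intro that[of q]) (auto simp: e_def)
qed

text \<open>Supply strictly increases and demand weakly decreases in the price, so a price with
  excess demand cannot exceed one with excess supply.\<close>

lemma market_clearing_crossing:
  assumes "0 < \<alpha>" "\<And>x. x \<in> space \<phi> \<Longrightarrow> 0 < k x" "0 < aggregate_supply \<phi> \<alpha> k B 1" "0 < e" "0 < q'"
    and "aggregate_supply \<phi> \<alpha> k B q \<le> 1 - cdf \<mu> (q / e)"
    and "1 - cdf \<mu> (q' / e) \<le> aggregate_supply \<phi> \<alpha> k B q'"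
  shows "q \<le> q'"
proof (rule ccontr)
  assume "\<not> q \<le> q'"
  then have "aggregate_supply \<phi> \<alpha> k B q' < aggregate_supply \<phi> \<alpha> k B q"
    using aggregate_supply_strict_mono assms by simp
  moreover have "cdf \<mu> (q' / e) \<le> cdf \<mu> (q / e)"
    using \<open>\<not> q \<le> q'\<close> \<open>0 < e\<close> by (intro cdf_nondecreasing) (simp add: divide_right_mono)
  ultimately show False using assms by simp
qed

end

section \<open>Comparison of the two revenues\<close>

theorem proposition7:
  fixes xbar \<alpha> a b :: real
    and \<phi> \<mu> :: "real measure"
    and Io :: "real set set"
    and k :: "real \<Rightarrow> real"
    and Bs :: "real set list"
    and ps :: "real list"
  defines "ls \<equiv> beliefs \<phi> \<alpha> k Bs ps"
  defines "es \<equiv> map mean_quality ls"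
  defines "J \<equiv> threshold_interval ps es"
  defines "B \<equiv> last Bs"
  defines "pM \<equiv> monopoly_price \<mu> (last es)"
  assumes xbar: "0 < xbar"
    and phi: "prob_space \<phi>" "sets \<phi> = sets (restrict_space borel {0..xbar})"
    and Io: "finite Io" "partition_on {0..xbar} Io"
      "\<And>A. A \<in> Io \<Longrightarrow> A \<in> sets \<phi> \<and> 0 < measure \<phi> A"
    and alpha: "0 < \<alpha>"
    and k: "k \<in> borel_measurable \<phi>" "\<exists>c>0. \<forall>x\<in>{0..xbar}. c \<le> k x"
    and mu: "buyer_distribution a b \<mu>"
    and Bs: "info_structure Io Bs"
    and implementable: "implementable \<phi> \<alpha> k a b \<mu> Bs ps"
    and labeling: "sorted_wrt (<) es"
    and quasi_concave: "strictly_quasi_concave_on {a..b} (\<lambda>m. m * (1 - cdf \<mu> m))"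
  shows "(convex_on J (\<lambda>m. cdf \<mu> m * m) \<and>
            demand a b \<mu> [belief \<phi> \<alpha> k B pM] [pM] 0 \<le> aggregate_supply \<phi> \<alpha> k B pM \<longrightarrow>
            equilibrium_revenue \<phi> \<alpha> k a b \<mu> Bs \<le> equilibrium_revenue \<phi> \<alpha> k a b \<mu> [B])
       \<and> (concave_on J (\<lambda>m. cdf \<mu> m * m) \<and> pM \<le> last ps \<longrightarrow>
            equilibrium_revenue \<phi> \<alpha> k a b \<mu> [B] \<le> equilibrium_revenue \<phi> \<alpha> k a b \<mu> Bs)"
proof -
  interpret real_distribution \<mu> using mu by (simp add: buyer_distribution_def)
  have k_pos: "0 < k x" if "x \<in> space \<phi>" for x
  proof -
    have "space \<phi> = {0..xbar}"
      using sets_eq_imp_space_eq[OF phi(2)] by (simp add: space_restrict_space)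
    with k(2) that show ?thesis by force
  qed
  note AK = alpha k_pos
  obtain ls' where "equilibrium \<phi> \<alpha> k a b \<mu> Bs ps ls'"
    using implementable by (auto simp: implementable_def)
  note rev = equilibrium_revenue_eq[OF AK real_distribution_axioms this]
  have eq: "equilibrium \<phi> \<alpha> k a b \<mu> Bs ps ls"
    using rev(2) \<open>equilibrium \<phi> \<alpha> k a b \<mu> Bs ps ls'\<close> by (simp add: ls_def)
  define n where "n = length es"
  have "Bs \<noteq> []" using Bs by (simp add: info_structure_def)
  then have len: "0 < n" "length Bs = n" "length ps = n" "length ls = n" "length es = n"
    using eq by (auto simp: equilibrium_def n_def es_def)
  have eqi: "0 < ps ! i" "consistent_belief \<phi> \<alpha> k (Bs ! i) (ps ! i) (ls ! i)"
    "aggregate_supply \<phi> \<alpha> k (Bs ! i) (ps ! i) = measure \<mu> (choosers a b es ps i)" if "i < n" for i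
    using that eq len demand_eq_measure_choosers[of \<mu> i ls] by (auto simp: equilibrium_def es_def)
  have nonempty: "choosers a b es ps i \<noteq> {}" if "i < n" for i
    using consistent_belief_supply_pos[OF alpha eqi(1)[OF that] k_pos eqi(2)[OF that]] eqi(3)[OF that]
    by auto
  have es_pos: "0 < es ! i" if "i < n" for i
  proof -
    obtain m where m: "m \<in> choosers a b es ps i" using nonempty[of i] \<open>i < n\<close> by auto
    \<comment> \<open>A chooser has nonnegative utility although the price is positive.\<close>
    then have "0 \<le> m" "0 < m * es ! i"
      using eqi(1)[OF that] mu by (auto simp: choosers_def buyer_distribution_def)
    then show ?thesis by (simp add: zero_less_mult_iff)
  qed
  define e where "e = (!) (0 # es)"
  define p where "p = (!) (0 # ps)"
  define T where "T = threshold e p"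
  define G where "G = (\<lambda>m. cdf \<mu> m * m)"
  \<comment> \<open>Positivity of the first mean quality handles the step from the artificial index
    0; \<open>labeling\<close> handles the others.\<close>
  have e_less: "e i < e (Suc i)" if "i < n" for i
    using that es_pos[of 0] sorted_wrt_nth_less[OF labeling, of "i - 1" i]
    by (cases i) (auto simp: e_def n_def)
  note thr = e_less[unfolded e_def n_def] nonempty[unfolded n_def]
  have T_le: "T i \<le> T j" if "i \<le> j" "j < n" for i j
    using threshold_mono[OF thr, where i = i and j = j] that by (simp add: T_def e_def p_def n_def)
  \<comment> \<open>As the thresholds increase, all of them lie in \<open>J\<close>, which is what
    Jensen's inequality requires.\<close>
  have J: "J = {T 0..T (n - 1)}"
    using len by (simp add: J_def threshold_interval_def T_def threshold_def e_def p_def)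
  have revI: "equilibrium_revenue \<phi> \<alpha> k a b \<mu> Bs = p n - (\<Sum>i<n. (e (Suc i) - e i) * G (T i))"
  proof -
    have "equilibrium_revenue \<phi> \<alpha> k a b \<mu> Bs = (\<Sum>i<n. ps ! i * measure \<mu> (choosers a b es ps i))"
      using rev len demand_eq_measure_choosers[of \<mu> _ ls] by (simp add: ls_def es_def)
    also have "\<dots> = p n - (\<Sum>i<n. (e (Suc i) - e i) * G (T i))"
      using threshold_revenue(1)[OF mu thr] len(1) by (simp add: T_def G_def e_def p_def flip: n_def)
    finally show ?thesis .
  qed
  have supply_n: "aggregate_supply \<phi> \<alpha> k B (p n) = 1 - cdf \<mu> (T (n - 1))"
  proof -
    have "ps ! (n - 1) = p n" "B = Bs ! (n - 1)"
      using len \<open>Bs \<noteq> []\<close> by (auto simp: p_def B_def last_conv_nth)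
    then show ?thesis
      using eqi(3)[of "n - 1"] threshold_revenue(2)[OF mu thr] len(1)
      by (simp add: T_def e_def p_def flip: n_def)
  qed

  define l where "l = ls ! (n - 1)"
  have ne: "ps \<noteq> []" "ls \<noteq> []" using len by auto
  have last: "last ps = p n" "last es = e n" "mean_quality l = e n" "B = Bs ! (n - 1)"
    using len ne \<open>Bs \<noteq> []\<close> by (auto simp: p_def e_def B_def l_def es_def last_conv_nth)
  have "0 < e n" "0 < p n"
    using es_pos[of "n - 1"] eqi(1)[of "n - 1"] len by (auto simp: e_def p_def)
  have l: "consistent_belief \<phi> \<alpha> k B 1 l"
    using consistent_belief_cong_price[of \<alpha> "ps ! (n - 1)" 1 \<phi> k] eqi[of "n - 1"] len AK
    by (simp add: last(4) l_def)
  have supply1: "0 < aggregate_supply \<phi> \<alpha> k B 1"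
    using consistent_belief_supply_pos[OF alpha _ k_pos l] by simp
  obtain q where q: "0 < q" "aggregate_supply \<phi> \<alpha> k B q = 1 - cdf \<mu> (q / e n)"
    "equilibrium_revenue \<phi> \<alpha> k a b \<mu> [B] = q * (1 - cdf \<mu> (q / e n))"
    using single_equilibrium[OF mu AK l] \<open>0 < e n\<close> last(3) by auto

  define w where "w = (\<lambda>i. (e (Suc i) - e i) / e n)"
  have w_nonneg: "0 \<le> w i" if "i < n" for i
    using e_less[OF that] \<open>0 < e n\<close> by (simp add: w_def)
  have w_sum: "(\<Sum>i<n. w i) = 1"
  proof -
    have "e 0 = 0" by (simp add: e_def)
    then show ?thesis
      using sum_lessThan_telescope[of e n] \<open>0 < e n\<close>
      by (simp add: w_def sum_divide_distrib[symmetric])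
  qed
  have w_scale: "(\<Sum>i<n. (e (Suc i) - e i) * f i) = e n * (\<Sum>i<n. w i * f i)" for f
    using \<open>0 < e n\<close> by (simp add: w_def sum_distrib_left)
  have w_T: "(\<Sum>i<n. w i * T i) = p n / e n"
    using threshold_average[of n e p] e_less w_scale[of T] \<open>0 < e n\<close>
    by (simp add: T_def p_def field_simps)
  have "p n / e n \<le> (\<Sum>i<n. w i * T (n - 1))"
    unfolding w_T[symmetric] using w_nonneg T_le by (intro sum_mono mult_left_mono) auto
  also have "\<dots> = T (n - 1)" by (simp add: sum_distrib_right[symmetric] w_sum)
  finally have "cdf \<mu> (p n / e n) \<le> cdf \<mu> (T (n - 1))" by (rule cdf_nondecreasing)
  \<comment> \<open>At \<open>p n\<close> the supply equals the demand of the types above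
    \<open>T (n - 1)\<close>, which is at most the demand \<open>1 - cdf \<mu> (p n / e n)\<close>
    for the last set alone.\<close>
  then have p_le_q: "p n \<le> q"
    using market_clearing_crossing[OF mu AK, where B = B and e = "e n" and q = "p n" and q' = q]
      supply_n q \<open>0 < e n\<close> supply1
    by simp

  \<comment> \<open>Dividing prices by \<open>e n\<close> turns the revenue of the last set into
    \<open>m * (1 - cdf \<mu> m)\<close> up to the factor \<open>e n\<close>, so quasi-concavity in
    the type applies.\<close>
  define M where "M = pM / e n"
  have pM: "0 < pM" "0 \<le> x \<Longrightarrow> x * (1 - cdf \<mu> (x / e n)) \<le> pM * (1 - cdf \<mu> (pM / e n))" for x
    using monopoly_price[OF mu \<open>0 < e n\<close>] by (auto simp: pM_def last(2))
  have "0 < M" using pM(1) \<open>0 < e n\<close> by (simp add: M_def)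
  have M_max: "x * (1 - cdf \<mu> x) \<le> M * (1 - cdf \<mu> M)" if "0 \<le> x" for x
    using pM(2)[of "x * e n"] that \<open>0 < e n\<close> by (simp add: M_def field_simps)
  note unimodal = revenue_unimodal[OF mu quasi_concave M_max less_imp_le[OF \<open>0 < M\<close>]]
  have R_pn: "p n - e n * G (p n / e n) = p n * (1 - cdf \<mu> (p n / e n))"
    using \<open>0 < e n\<close> by (simp add: G_def algebra_simps)

  show ?thesis
  proof (intro conjI impI; elim conjE)
    assume cvx: "convex_on J (\<lambda>m. cdf \<mu> m * m)"
      and D: "demand a b \<mu> [belief \<phi> \<alpha> k B pM] [pM] 0 \<le> aggregate_supply \<phi> \<alpha> k B pM"
    have "G (\<Sum>i<n. w i *\<^sub>R T i) \<le> (\<Sum>i<n. w i * G (T i))"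
      using cvx w_sum w_nonneg len(1) T_le
      by (intro convex_on_sum[where C = J]) (auto simp: J G_def[abs_def])
    then have le: "equilibrium_revenue \<phi> \<alpha> k a b \<mu> Bs \<le> p n * (1 - cdf \<mu> (p n / e n))"
      unfolding revI R_pn[symmetric] w_scale using \<open>0 < e n\<close> by (simp add: w_T)
    have "belief \<phi> \<alpha> k B pM = l"
      using belief_eqI[of \<phi> \<alpha> k B pM l] consistent_belief_cong_price[of \<alpha> pM 1 \<phi> k] l pM(1) AK
      by simp
    then have "1 - cdf \<mu> (pM / e n) \<le> aggregate_supply \<phi> \<alpha> k B pM"
      using D demand_single[OF mu, of l pM] last(3) \<open>0 < e n\<close> by simp
    \<comment> \<open>The supply hypothesis says that \<open>pM\<close> is a price of excess supply,
      while the market clears at \<open>q\<close>.\<close>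
    then have "q \<le> pM"
      using market_clearing_crossing[OF mu AK, where B = B and e = "e n" and q = q and q' = pM]
        \<open>0 < e n\<close> q(2) supply1 pM(1)
      by simp
    then have "0 \<le> p n / e n" "p n / e n \<le> q / e n" "q / e n \<le> M"
      using p_le_q \<open>0 < p n\<close> \<open>0 < e n\<close> by (auto simp: M_def divide_right_mono)
    then have "p n / e n * (1 - cdf \<mu> (p n / e n)) \<le> q / e n * (1 - cdf \<mu> (q / e n))"
      by (intro unimodal(1))
    then have "p n * (1 - cdf \<mu> (p n / e n)) \<le> q * (1 - cdf \<mu> (q / e n))"
      using \<open>0 < e n\<close> by (simp add: divide_le_cancel)
    with le show "equilibrium_revenue \<phi> \<alpha> k a b \<mu> Bs \<le> equilibrium_revenue \<phi> \<alpha> k a b \<mu> [B]"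
      by (simp add: q(3))
  next
    assume ccv: "concave_on J (\<lambda>m. cdf \<mu> m * m)" and "pM \<le> last ps"
    have "(\<Sum>i<n. w i * G (T i)) \<le> G (\<Sum>i<n. w i *\<^sub>R T i)"
      using ccv w_sum w_nonneg len(1) T_le
      by (intro concave_on_sum[where C = J]) (auto simp: J G_def[abs_def])
    then have le: "p n * (1 - cdf \<mu> (p n / e n)) \<le> equilibrium_revenue \<phi> \<alpha> k a b \<mu> Bs"
      unfolding revI R_pn[symmetric] w_scale using \<open>0 < e n\<close> by (simp add: w_T)
    have "M \<le> p n / e n" "p n / e n \<le> q / e n"
      using p_le_q \<open>pM \<le> last ps\<close> last(1) \<open>0 < e n\<close> by (auto simp: M_def divide_right_mono)
    then have "q / e n * (1 - cdf \<mu> (q / e n)) \<le> p n / e n * (1 - cdf \<mu> (p n / e n))"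
      by (intro unimodal(2))
    then have "q * (1 - cdf \<mu> (q / e n)) \<le> p n * (1 - cdf \<mu> (p n / e n))"
      using \<open>0 < e n\<close> by (simp add: divide_le_cancel)
    with le show "equilibrium_revenue \<phi> \<alpha> k a b \<mu> [B] \<le> equilibrium_revenue \<phi> \<alpha> k a b \<mu> Bs"
      by (simp add: q(3))
  qed
qed

end
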